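(* Let $n\ge2$ and $(p,q)\in\mathcal P_n=\{(1,n-1),(n-1,1)\}\cup\{2,\ldots,n-1\}^2$. The smallest length $L$ of a finite sequence $w=(i_1,\ldots,i_L)$ in $\{1,\ldots,n-1\}$ for which there are positive parameters and a positive diagonal matrix $\Delta$ such that $$A=U(w)^T\Delta U(w)$$ (same parameters in both factors) is an oscillatory matrix of order $n$ with $(\operatorname{bw}A,\operatorname{bw}A^{-1})=(p,q)$ is $$L_{\min}(n;p,q)=\max\{n-1,\,p+q-1\}.$$ (Only the factors in $U(w)$ are counted; the minimum is over the matrices, the sequences, the positive parameters and the positive diagonal matrices $\Delta$.)
   Context: All matrices are real. A matrix is totally nonnegative (TN) if all its minors are nonnegative and totally positive (TP) if all its minors are positive. A square TN matrix is oscillatory if some positive integer power of it is TP. For a square matrix $M=(m_{ij})$, $\operatorname{bw}M=\max(\{0\}\cup\{|i-j|:m_{ij}\ne0\})$ (half-bandwidth). For $1\le i<n$ and $a>0$, $x_i(a)=I+aE_{i,i+1}$, where $E_{ij}$ is the $n\times n$ matrix with single nonzero entry one in position $(i,j)$. For a finite sequence $w=(i_1,\ldots,i_L)$ of indices in $\{1,\ldots,n-1\}$ and positive parameters $a_1,\ldots,a_L$ (different occurrences may have different parameters), $U(w)=x_{i_1}(a_1)\cdots x_{i_L}(a_L)$. A positive diagonal matrix is a diagonal matrix with positive diagonal entries. For $n=2$, $\mathcal P_2=\{(1,1)\}$. *)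

theory Defs
  imports Jordan_Normal_Form.Determinant Jordan_Normal_Form.DL_Submatrix
begin

(* Square matrices of order n are elements of carrier_mat n n and are indexed from 0,
   whereas the indices i of the factors x_i(a) and of the matrix units E_ij run from 1. *)

definition totally_nonnegative :: "real mat \<Rightarrow> bool" where
  "totally_nonnegative A \<longleftrightarrow>
     (\<forall>I J. I \<subseteq> {..<dim_row A} \<longrightarrow> J \<subseteq> {..<dim_col A} \<longrightarrow> I \<noteq> {} \<longrightarrow> card I = card J \<longrightarrow>
        0 \<le> det (submatrix A I J))"

definition totally_positive :: "real mat \<Rightarrow> bool" where
  "totally_positive A \<longleftrightarrow>
     (\<forall>I J. I \<subseteq> {..<dim_row A} \<longrightarrow> J \<subseteq> {..<dim_col A} \<longrightarrow> I \<noteq> {} \<longrightarrow> card I = card J \<longrightarrow>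
        0 < det (submatrix A I J))"

definition oscillatory :: "real mat \<Rightarrow> bool" where
  "oscillatory A \<longleftrightarrow>
     square_mat A \<and> totally_nonnegative A \<and> (\<exists>k>0. totally_positive (A ^\<^sub>m k))"

definition bw :: "real mat \<Rightarrow> nat" where
  "bw M = Max ({0} \<union> {nat \<bar>int i - int j\<bar> | i j. i < dim_row M \<and> j < dim_col M \<and> M $$ (i, j) \<noteq> 0})"

definition mat_unit :: "nat \<Rightarrow> nat \<Rightarrow> nat \<Rightarrow> real mat" where
  "mat_unit n i j = mat n n (\<lambda>(r, c). if r + 1 = i \<and> c + 1 = j then 1 else 0)"

definition elem_factor :: "nat \<Rightarrow> nat \<Rightarrow> real \<Rightarrow> real mat" where
  "elem_factor n i a = 1\<^sub>m n + a \<cdot>\<^sub>m mat_unit n i (i + 1)"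

(* U(w) = x_{i_1}(a_1) ... x_{i_L}(a_L) for w = [i_1, ..., i_L] and as = [a_1, ..., a_L];
   only meant for lists of equal length. *)
definition U_mat :: "nat \<Rightarrow> nat list \<Rightarrow> real list \<Rightarrow> real mat" where
  "U_mat n w as = foldr (*) (map2 (elem_factor n) w as) (1\<^sub>m n)"

definition positive_diagonal :: "nat \<Rightarrow> real mat \<Rightarrow> bool" where
  "positive_diagonal n D \<longleftrightarrow> D \<in> carrier_mat n n \<and> diagonal_mat D \<and> (\<forall>i<n. 0 < D $$ (i, i))"

definition admissible_pairs :: "nat \<Rightarrow> (nat \<times> nat) set" where
  "admissible_pairs n = {(1, n - 1), (n - 1, 1)} \<union> {2..n - 1} \<times> {2..n - 1}"

(* A is oscillatory of order n with (bw A, bw A^{-1}) = (p, q); B is the (unique) inverse of A. *)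
definition oscillatory_with_bandwidths :: "nat \<Rightarrow> nat \<Rightarrow> nat \<Rightarrow> real mat \<Rightarrow> bool" where
  "oscillatory_with_bandwidths n p q A \<longleftrightarrow>
     A \<in> carrier_mat n n \<and> oscillatory A \<and> bw A = p \<and>
     (\<exists>B \<in> carrier_mat n n. inverts_mat A B \<and> inverts_mat B A \<and> bw B = q)"

definition factorization_lengths :: "nat \<Rightarrow> nat \<Rightarrow> nat \<Rightarrow> nat set" where
  "factorization_lengths n p q =
     {length w | w as D.
        set w \<subseteq> {1..n - 1} \<and> length as = length w \<and> (\<forall>a \<in> set as. 0 < a) \<and>
        positive_diagonal n D \<and>
        oscillatory_with_bandwidths n p q (transpose_mat (U_mat n w as) * D * U_mat n w as)}"

end

theory Submission
  imports Defs "HOL-Library.Sublist"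
begin

text \<open>
  Entry \<open>(i, j)\<close> of \<open>U(w)\<close> is nonzero iff \<open>w\<close> contains the increasing run \<open>i, i + 1, \<dots>, j - 1\<close> as a
  (not necessarily contiguous) subsequence. Since no cancellation occurs in \<open>U\<^sup>T \<Delta> U\<close>, the bandwidth of \<open>A\<close>
  is the length of the longest such run. Up to checkerboard signs, the inverse of \<open>U(w)\<close> is \<open>U\<close> of the
  reversed word, so the bandwidth of the inverse of \<open>A\<close> is the length of the longest run in the reversed word.
  An increasing and a decreasing subsequence share at most one position, whence \<open>p + q \<le> L + 1\<close>.

  Moreover \<open>A\<close> is oscillatory iff every letter occurs in \<open>w\<close>, whence \<open>n - 1 \<le> L\<close>. A missing letter makes all
  powers of \<open>A\<close> block diagonal. Conversely, multiplication by an elementary factor adds a multiple of a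
  column to a neighbouring one; by linearity of the determinant in that column this keeps minors
  nonnegative and positive minors positive, and it makes a minor positive if moving one of its column
  indices by one step gives a positive minor. As any two index sets of equal size are connected by such
  moves, high powers of \<open>A\<close> are totally positive. No Cauchy-Binet formula is needed.
\<close>

section \<open>Runs in words\<close>

text \<open>The empty run puts 0 into the set and no run is longer than \<open>w\<close>, so
  \<open>Max\<close> is well defined.\<close>

definition longest_run :: "nat list \<Rightarrow> nat" where
  "longest_run w = Max {l. \<exists>i. subseq [i..<i + l] w}"

lemma finite_run_lengths: "finite {l. \<exists>i. subseq [i..<i + l] w}"
  by (rule finite_subset[of _ "{..length w}"]) (auto dest!: list_emb_length)

lemma longest_run_ge: "subseq [i..<j] w \<Longrightarrow> j - i \<le> longest_run w"
  unfolding longest_run_def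
  by (rule Max_ge[OF finite_run_lengths]) (cases "i \<le> j", auto intro!: exI[of _ i])

lemma longest_run_attained: "\<exists>i. subseq [i..<i + longest_run w] w"
proof -
  have "{l. \<exists>i. subseq [i..<i + l] w} \<noteq> {}"
    by (auto intro!: exI[of _ 0])
  from Max_in[OF finite_run_lengths this] show ?thesis
    by (simp add: longest_run_def)
qed

lemma subseq_upt: "a \<le> c \<Longrightarrow> d \<le> b \<Longrightarrow> subseq [c..<d] [a..<b]"
  by (rule sorted_subset_imp_subseq) auto

lemma subseq_rev: "subseq xs ys \<Longrightarrow> subseq (rev xs) (rev ys)"
  by (induction rule: list_emb.induct) (auto intro: list_emb_append_mono)

lemma subseq_rev_iff: "subseq (rev xs) ys \<longleftrightarrow> subseq xs (rev ys)"
  using subseq_rev[of "rev xs" ys] subseq_rev[of xs "rev ys"] by auto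

lemma set_subseq: "subseq xs ys \<Longrightarrow> set xs \<subseteq> set ys"
  by (induction rule: list_emb.induct) auto

lemma sorted_wrt_subseq: "subseq xs ys \<Longrightarrow> sorted_wrt P ys \<Longrightarrow> sorted_wrt P xs"
  by (induction rule: list_emb.induct) (auto dest: set_subseq)

text \<open>Every run longer than \<open>l\<close> has a prefix that is a run of length
  \<open>l + 1\<close>, so it suffices to exclude that one length.\<close>

lemma longest_run_eqI:
  assumes "subseq [i..<i + l] w" and "\<And>i. \<not> subseq [i..<i + Suc l] w"
  shows "longest_run w = l"
proof (rule antisym)
  obtain j where j: "subseq [j..<j + longest_run w] w"
    using longest_run_attained by blast
  show "longest_run w \<le> l"
  proof (rule ccontr)
    assume "\<not> longest_run w \<le> l"
    then have "subseq [j..<j + Suc l] [j..<j + longest_run w]"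
      by (intro subseq_upt) auto
    with j have "subseq [j..<j + Suc l] w"
      by (blast intro: subseq_order.order_trans)
    with assms(2) show False by blast
  qed
  show "l \<le> longest_run w"
    using longest_run_ge[OF assms(1)] by simp
qed

text \<open>Each position of \<open>w\<close> serves at most one of the two lists, as they share no
  letter.\<close>

lemma subseq_disjoint_length:
  assumes "subseq xs w" "subseq ys w" "set xs \<inter> set ys = {}"
  shows "length xs + length ys \<le> length w"
  using assms
proof (induction w arbitrary: xs ys rule: list.induct)
  case (Cons c w)
  have *: "subseq zs w \<or> (\<exists>zs'. zs = c # zs' \<and> subseq zs' w)" if "subseq zs (c # w)" for zs
    using that by (cases zs) (auto split: if_splits)
  from *[OF Cons.prems(1)] *[OF Cons.prems(2)] show ?case
  proof (elim disjE exE conjE)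
    fix xs' ys' assume "xs = c # xs'" "ys = c # ys'"
    with Cons.prems(3) show ?thesis by simp
  qed (use Cons.IH[of xs ys] Cons.IH[of "tl xs" ys] Cons.IH[of xs "tl ys"] Cons.prems(3) in auto)
qed simp

text \<open>Once a position with letter \<open>c\<close> serves both lists, the remaining letters of
  \<open>xs\<close> exceed \<open>c\<close> and those of \<open>ys\<close> are below it. So at most
  one position is counted twice.\<close>

lemma subseq_increasing_decreasing_length:
  fixes xs ys w :: "nat list"
  assumes "subseq xs w" "subseq ys w" "sorted_wrt (<) xs" "sorted_wrt (>) ys"
  shows "length xs + length ys \<le> length w + 1"
  using assms
proof (induction w arbitrary: xs ys rule: list.induct)
  case (Cons c w)
  have *: "subseq zs w \<or> (\<exists>zs'. zs = c # zs' \<and> subseq zs' w)" if "subseq zs (c # w)" for zs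
    using that by (cases zs) (auto split: if_splits)
  from *[OF Cons.prems(1)] *[OF Cons.prems(2)] show ?case
  proof (elim disjE exE conjE)
    fix xs' ys' assume eq: "xs = c # xs'" "ys = c # ys'" and sub: "subseq xs' w" "subseq ys' w"
    from eq Cons.prems have "set xs' \<inter> set ys' = {}"
      by fastforce
    from subseq_disjoint_length[OF sub this] eq show ?thesis by simp
  qed (use Cons.IH[of xs ys] Cons.IH[of "tl xs" ys] Cons.IH[of xs "tl ys"] Cons.prems in auto)
qed (auto dest!: list_emb_Nil2)

text \<open>Source of the bound \<open>p + q - 1 \<le> L\<close>: a run in \<open>rev w\<close> is a
  decreasing subsequence of \<open>w\<close>.\<close>

lemma longest_run_add_rev: "longest_run w + longest_run (rev w) \<le> length w + 1"
proof -
  obtain i where i: "subseq [i..<i + longest_run w] w"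
    using longest_run_attained by blast
  obtain j where j: "subseq [j..<j + longest_run (rev w)] (rev w)"
    using longest_run_attained by blast
  then have "subseq (rev [j..<j + longest_run (rev w)]) w"
    by (simp add: subseq_rev_iff)
  from subseq_increasing_decreasing_length[OF i this] show ?thesis
    by (simp add: sorted_wrt_rev)
qed

section \<open>Neighbouring letters in words\<close>

lemma subseq_pair_append_iff:
  "subseq [x, y] (us @ vs) \<longleftrightarrow> subseq [x, y] us \<or> x \<in> set us \<and> y \<in> set vs \<or> subseq [x, y] vs"
proof (induction us)
  case (Cons u us)
  then show ?case
    by (cases "x = u") (auto simp: subseq_singleton_left dest: set_subseq)
qed (auto dest: set_subseq)

lemma subseq_pair_decreasing:
  "sorted_wrt (>) us \<Longrightarrow> x < y \<Longrightarrow> \<not> subseq [x, y] us" for x :: nat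
  by (auto dest!: sorted_wrt_subseq)

lemma subseq_pair_increasing:
  "sorted_wrt (<) us \<Longrightarrow> y < x \<Longrightarrow> \<not> subseq [x, y] us" for x :: nat
  by (auto dest!: sorted_wrt_subseq)

lemma upt_pair: "i \<le> k \<Longrightarrow> k + 1 < j \<Longrightarrow> subseq [k, k + 1] [i..<j]"
  using subseq_upt[of i k "k + 2" j] by (simp add: upt_rec)

lemma run_pair:
  "subseq [i..<j] w \<Longrightarrow> i \<le> k \<Longrightarrow> k + 1 < j \<Longrightarrow> subseq [k, k + 1] w"
  by (blast intro: subseq_order.order_trans upt_pair)

lemma run_pair_rev:
  assumes "subseq [i..<j] (rev w)" "i \<le> k" "k + 1 < j"
  shows "subseq [k + 1, k] w"
proof -
  have "subseq [k, k + 1] (rev w)"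
    using assms by (rule run_pair)
  then show ?thesis
    by (simp add: subseq_rev_iff[symmetric])
qed

lemma run_bounds:
  assumes "subseq [i..<i + Suc l] w" "set w \<subseteq> {1..n - 1}"
  shows "1 \<le> i" "i + l \<le> n - 1"
proof -
  have "i \<in> set w" "i + l \<in> set w"
    using set_subseq[OF assms(1)] by (auto simp del: upt_Suc)
  with assms(2) show "1 \<le> i" "i + l \<le> n - 1" by auto
qed

text \<open>Each letter satisfying \<^term>\<open>P\<close> is put in front of all smaller letters, every other one behind
  them, so \<open>k + 1\<close> precedes \<open>k\<close> iff \<open>P (k + 1)\<close>.\<close>

definition split_word :: "(nat \<Rightarrow> bool) \<Rightarrow> nat \<Rightarrow> nat list" where
  "split_word P n = rev (filter P [1..<n]) @ filter (\<lambda>i. \<not> P i) [1..<n]"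

lemma set_split_word: "n \<ge> 1 \<Longrightarrow> set (split_word P n) = {1..n - 1}"
  by (auto simp: split_word_def)

lemma length_split_word: "length (split_word P n) = n - 1"
  using sum_length_filter_compl[of P "[1..<n]"] by (simp add: split_word_def)

lemma split_word_ascent: "subseq [k, k + 1] (split_word P n) \<Longrightarrow> \<not> P (k + 1)"
  unfolding split_word_def subseq_pair_append_iff
  using subseq_pair_decreasing[of "rev (filter P [1..<n])" k "k + 1"]
    set_subseq[of "[k, k + 1]" "filter (\<lambda>i. \<not> P i) [1..<n]"]
  by (auto simp: sorted_wrt_rev sorted_wrt_filter)

lemma split_word_descent: "subseq [k + 1, k] (split_word P n) \<Longrightarrow> P (k + 1)"
  unfolding split_word_def subseq_pair_append_iff
  using subseq_pair_increasing[of "filter (\<lambda>i. \<not> P i) [1..<n]" "k" "k + 1"]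
    set_subseq[of "[k + 1, k]" "rev (filter P [1..<n])"]
  by (auto simp: sorted_wrt_filter)

section \<open>Words that attain the bounds\<close>

text \<open>Letters up to \<open>p\<close> go behind and form an increasing run of length
  \<open>p\<close>. Those from \<open>p + 1\<close> to \<open>p + q - 1\<close> go in front and,
  followed by \<open>p\<close>, form a decreasing run of length \<open>q\<close>. From
  \<open>p + q\<close> on \<open>P\<close> alternates, which limits further runs to two letters;
  this is harmless if \<open>p\<close> and \<open>q\<close> are at least 2, and there are no such
  letters if \<open>p + q = n\<close>.\<close>

lemma word_exists_short:
  assumes "1 \<le> p" "1 \<le> q" "p + q \<le> n" "2 \<le> p \<and> 2 \<le> q \<or> p + q = n"
  shows "\<exists>w. length w = n - 1 \<and> set w = {1..n - 1} \<and> longest_run w = p \<and> longest_run (rev w) = q"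
proof -
  define P where "P i \<longleftrightarrow> p < i \<and> i < p + q \<or> p + q \<le> i \<and> odd (i - (p + q))" for i
  let ?w = "split_word P n"
  have set: "set ?w = {1..n - 1}"
    using assms by (intro set_split_word) auto
  have 1: "longest_run ?w = p"
  proof (rule longest_run_eqI[of 1])
    have "filter (\<lambda>i. \<not> P i) [1..<1 + p] = [1..<1 + p]"
      by (auto simp: filter_id_conv P_def)
    then have "subseq [1..<1 + p] (filter (\<lambda>i. \<not> P i) [1..<n])"
      using subseq_filter[OF subseq_upt[of 1 1 "1 + p" n]] assms by (metis add.commute add_le_cancel_left le_refl le_trans)
    then show "subseq [1..<1 + p] ?w"
      by (auto simp: split_word_def)
  next
    fix i show "\<not> subseq [i..<i + Suc p] ?w"
    proof
      assume run: "subseq [i..<i + Suc p] ?w"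
      note b = run_bounds[OF run eq_refl[OF set]]
      have nP: "\<not> P (k + 1)" if "i \<le> k" "k < i + p" for k
        using split_word_ascent[OF run_pair[OF run]] that by simp
      \<comment> \<open>The top letter exceeds \<open>p\<close> and violates \<open>P\<close>, so it
        lies in the alternating range. That range is nonempty only for \<open>p + q < n\<close>,
        which forces \<open>2 \<le> p\<close> and \<open>2 \<le> q\<close>.\<close>
      have "\<not> P (i + p)"
        using nP[of "i + p - 1"] assms by simp
      with b assms have i: "q \<le> i" "even (i - q)" "2 \<le> p" "2 \<le> q"
        by (auto simp: P_def)
      \<comment> \<open>The letter below violates \<open>P\<close> as well, but it is either
        \<open>p + q - 1\<close>, where \<open>P\<close> holds, or of the wrong parity.\<close>
      have "\<not> P (i + p - 1)"
        using nP[of "i + p - 2"] i by (simp add: numeral_2_eq_2 Suc_diff_Suc)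
      with i b have "q < i" "even (i - 1 - q)"
        by (auto simp: P_def not_less diff_diff_left add.commute)
      with i show False
        by (auto simp: even_diff_nat)
    qed
  qed
  have 2: "longest_run (rev ?w) = q"
  proof (rule longest_run_eqI[of p])
    have "filter P [p + 1..<p + q] = [p + 1..<p + q]"
      by (auto simp: filter_id_conv P_def)
    then have "subseq [p + 1..<p + q] (filter P [1..<n])"
      using subseq_filter[OF subseq_upt[of 1 "p + 1" "p + q" n], of P] assms by simp
    then have "subseq (rev [p + 1..<p + q]) (rev (filter P [1..<n]))"
      by (rule subseq_rev)
    moreover have "subseq [p] (filter (\<lambda>i. \<not> P i) [1..<n])"
      using assms by (auto simp: subseq_singleton_left P_def)
    ultimately have "subseq (rev [p + 1..<p + q] @ [p]) ?w"
      unfolding split_word_def by (rule list_emb_append_mono)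
    then have "subseq (rev [p..<p + q]) ?w"
      using assms by (simp add: upt_rec[of p])
    then show "subseq [p..<p + q] (rev ?w)"
      by (simp add: subseq_rev_iff)
  next
    fix i show "\<not> subseq [i..<i + Suc q] (rev ?w)"
    proof
      assume run: "subseq [i..<i + Suc q] (rev ?w)"
      have b: "1 \<le> i" "i + q \<le> n - 1"
        using run_bounds[OF run] set by auto
      have P: "P (k + 1)" if "i \<le> k" "k < i + q" for k
        using split_word_descent[OF run_pair_rev[OF run]] that by simp
      \<comment> \<open>\<open>P (i + 1)\<close> gives \<open>p \<le> i\<close>, so the top letter
        \<open>i + q\<close> is in the alternating range. By parity \<open>i\<close> differs from
        \<open>p\<close>, so the letter below is in that range too and has the wrong parity.\<close>
      have "P (i + 1)" "P (i + q)"
        using P[of i] P[of "i + q - 1"] assms by simp_all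
      with b assms have i: "p \<le> i" "odd (i - p)" "2 \<le> q"
        by (auto simp: P_def)
      then have "p < i"
        by (cases "i = p") auto
      have "P (i + q - 1)"
        using P[of "i + q - 2"] i by (simp add: numeral_2_eq_2 Suc_diff_Suc)
      with i \<open>p < i\<close> have "odd (i - 1 - p)"
        by (auto simp: P_def diff_diff_left add.commute)
      with i \<open>p < i\<close> show False
        by (auto simp: even_diff_nat)
    qed
  qed
  show ?thesis
    using 1 2 set length_split_word by blast
qed

text \<open>The word is \<open>n-1, ..., p+1\<close>, then \<open>1, ..., p\<close>, then
  \<open>p-1, ..., n-q\<close>. The increasing run \<open>1, ..., p\<close> and the decreasing run
  \<open>n-1, ..., n-q\<close> together use all positions and share only that of \<open>p\<close>,
  so \<open>longest_run_add_rev\<close> holds with equality.\<close>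

lemma word_exists_long:
  assumes "2 \<le> p" "p \<le> n - 1" "2 \<le> q" "q \<le> n - 1" "n < p + q"
  shows "\<exists>w. length w = p + q - 1 \<and> set w = {1..n - 1} \<and> longest_run w = p \<and> longest_run (rev w) = q"
proof -
  define us where "us = rev [p + 1..<n]"
  define vs where "vs = [1..<p + 1]"
  define zs where "zs = rev [n - q..<p]"
  let ?w = "us @ vs @ zs"
  have set: "set ?w = {1..n - 1}"
    using assms by (auto simp: us_def vs_def zs_def)
  have 1: "longest_run ?w = p"
  proof (rule longest_run_eqI[of 1])
    show "subseq [1..<1 + p] ?w"
      by (simp add: vs_def add.commute subseq_drop_many subseq_rev_drop_many)
  next
    fix i show "\<not> subseq [i..<i + Suc p] ?w"
    proof
      assume run: "subseq [i..<i + Suc p] ?w"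
      note b = run_bounds[OF run eq_refl[OF set]]
      \<comment> \<open>The top letter \<open>k + 1 = i + p\<close> exceeds \<open>p\<close>, hence
        occurs only in the decreasing block \<open>us\<close>.\<close>
      define k where "k = i + p - 1"
      have "subseq [k, k + 1] ?w"
        using run_pair[OF run, of k] assms by (simp add: k_def)
      moreover have "k + 1 \<notin> set vs" "k + 1 \<notin> set zs"
        using b by (auto simp: vs_def zs_def k_def)
      ultimately have "subseq [k, k + 1] us"
        by (auto simp: subseq_pair_append_iff dest: set_subseq)
      then show False
        using subseq_pair_decreasing[of us k "k + 1"] by (simp add: us_def sorted_wrt_rev)
    qed
  qed
  have 2: "longest_run (rev ?w) = q"
  proof (rule longest_run_eqI[of "n - q"])
    have "[n - q..<n] = [n - q..<p] @ p # [p + 1..<n]"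
      using assms upt_add_eq_append[of "n - q" p "n - p"] by (simp add: upt_conv_Cons)
    then have "rev [n - q..<n] = us @ [p] @ zs"
      by (simp add: us_def zs_def)
    moreover have "subseq (us @ [p] @ zs) ?w"
      using assms by (auto intro!: list_emb_append_mono simp: subseq_singleton_left vs_def)
    ultimately show "subseq [n - q..<n - q + q] (rev ?w)"
      using assms by (metis le_add_diff_inverse2 subseq_rev_iff diff_le_self le_trans)
  next
    fix i show "\<not> subseq [i..<i + Suc q] (rev ?w)"
    proof
      assume run: "subseq [i..<i + Suc q] (rev ?w)"
      have b: "1 \<le> i" "i + q \<le> n - 1"
        using run_bounds[OF run] set by auto
      \<comment> \<open>Here \<open>i < n - q\<close> and \<open>i + 1 \<le> p\<close>, so this
        descent would have to lie inside the increasing block \<open>vs\<close>.\<close>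
      have "subseq [i + 1, i] ?w"
        using run_pair_rev[OF run, of i] assms by simp
      moreover have "i \<notin> set us" "i \<notin> set zs" "i + 1 \<notin> set us"
        using b assms by (auto simp: us_def zs_def)
      ultimately have "subseq [i + 1, i] vs"
        by (auto simp: subseq_pair_append_iff dest: set_subseq)
      then show False
        using subseq_pair_increasing[of vs i "i + 1"] by (simp add: vs_def del: upt_Suc)
    qed
  qed
  have "length ?w = p + q - 1"
    using assms by (simp add: us_def vs_def zs_def)
  with set 1 2 show ?thesis by blast
qed

section \<open>Minors and column operations\<close>

text \<open>Index lists instead of sets allow one column index to be replaced by
  \<open>ys[k := d]\<close>, even if this creates a repetition.\<close>

definition minor :: "real mat \<Rightarrow> nat list \<Rightarrow> nat list \<Rightarrow> real" where
  "minor M xs ys = det (mat (length xs) (length xs) (\<lambda>(i, j). M $$ (xs ! i, ys ! j)))"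

definition index_list :: "nat \<Rightarrow> nat \<Rightarrow> nat list \<Rightarrow> bool" where
  "index_list n r xs \<longleftrightarrow> sorted_wrt (<) xs \<and> set xs \<subseteq> {..<n} \<and> length xs = r"

definition nonneg_minors :: "nat \<Rightarrow> real mat \<Rightarrow> bool" where
  "nonneg_minors n M \<longleftrightarrow>
     (\<forall>r xs ys. index_list n r xs \<longrightarrow> index_list n r ys \<longrightarrow> 0 \<le> minor M xs ys)"

text \<open>Quantifying over all \<open>M\<close> makes the property pass to products, so that it
  can be checked factor by factor.\<close>

definition pos_minors_preserving :: "nat \<Rightarrow> real mat \<Rightarrow> bool" where
  "pos_minors_preserving n E \<longleftrightarrow> E \<in> carrier_mat n n \<and>
     (\<forall>M \<in> carrier_mat n n. nonneg_minors n M \<longrightarrow> nonneg_minors n (M * E) \<and>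
        (\<forall>r xs ys. index_list n r xs \<longrightarrow> index_list n r ys \<longrightarrow>
           0 < minor M xs ys \<longrightarrow> 0 < minor (M * E) xs ys))"

lemma index_list_nth: "index_list n r xs \<Longrightarrow> i < r \<Longrightarrow> xs ! i < n"
  unfolding index_list_def by (metis lessThan_iff nth_mem subsetD)

lemma index_list_distinct: "index_list n r xs \<Longrightarrow> distinct xs"
  by (simp add: index_list_def strict_sorted_iff)

lemma index_list_length_le: "index_list n r xs \<Longrightarrow> r \<le> n"
  using card_mono[of "{..<n}" "set xs"] index_list_distinct[of n r xs]
  by (auto simp: index_list_def distinct_card)

text \<open>The three matrices have the same cofactors along column \<open>k\<close>, so Laplace
  expansion gives linearity in that column.\<close>

lemma det_add_column:
  fixes A B C :: "real mat"
  assumes carr: "A \<in> carrier_mat n n" "B \<in> carrier_mat n n" "C \<in> carrier_mat n n" and k: "k < n"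
    and eq: "\<And>i j. i < n \<Longrightarrow> j < n \<Longrightarrow> j \<noteq> k \<Longrightarrow> B $$ (i, j) = A $$ (i, j) \<and> C $$ (i, j) = A $$ (i, j)"
    and sum: "\<And>i. i < n \<Longrightarrow> A $$ (i, k) = B $$ (i, k) + a * C $$ (i, k)"
  shows "det A = det B + a * det C"
proof -
  have del: "mat_delete B i k = mat_delete A i k" "mat_delete C i k = mat_delete A i k" if "i < n" for i
    using carr that k eq by (auto simp: mat_delete_def intro!: eq_matI)
  then have cof: "cofactor B i k = cofactor A i k" "cofactor C i k = cofactor A i k" if "i < n" for i
    using that by (simp_all add: cofactor_def)
  show ?thesis
    unfolding laplace_expansion_column[OF carr(1) k] laplace_expansion_column[OF carr(2) k]
      laplace_expansion_column[OF carr(3) k] sum_distrib_left sum.distrib[symmetric]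
    by (rule sum.cong) (auto simp: cof sum algebra_simps)
qed

lemma minor_addcol_notin:
  assumes M: "M \<in> carrier_mat n n" and xs: "index_list n r xs" and ys: "index_list n r ys"
    and c: "c \<notin> set ys"
  shows "minor (addcol a c d M) xs ys = minor M xs ys"
proof -
  have len: "length xs = r" "length ys = r"
    using xs ys by (simp_all add: index_list_def)
  with c have "c \<noteq> ys ! i" if "i < r" for i
    using that by auto
  then show ?thesis
    unfolding minor_def using M len index_list_nth[OF xs] index_list_nth[OF ys]
    by (intro arg_cong[of _ _ det] cong_mat) auto
qed

text \<open>\<open>addcol a c d\<close> adds \<open>a\<close> times column \<open>d\<close> to
  column \<open>c\<close>. As \<open>ys\<close> has no repetition, only column \<open>k\<close> of
  the minor changes.\<close>

lemma minor_addcol: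
  assumes M: "M \<in> carrier_mat n n" and xs: "index_list n r xs" and ys: "index_list n r ys"
    and k: "k < r" and c: "ys ! k = c"
  shows "minor (addcol a c d M) xs ys = minor M xs ys + a * minor M xs (ys[k := d])"
proof -
  have len: "length xs = r" "length ys = r"
    using xs ys by (simp_all add: index_list_def)
  have "ys ! j = c \<longleftrightarrow> j = k" if "j < r" for j
    using index_list_distinct[OF ys] that k c len by (metis nth_eq_iff_index_eq)
  then show ?thesis
    unfolding minor_def using M len index_list_nth[OF xs] index_list_nth[OF ys] k c
    by (intro det_add_column[where n = r and k = k]) auto
qed

lemma minor_repeated:
  assumes "length xs = r" "length ys = r" "i < r" "j < r" "i \<noteq> j" "ys ! i = ys ! j"
  shows "minor M xs ys = 0"
  unfolding minor_def using assms
  by (intro det_identical_columns[of _ r i j]) (auto intro!: eq_vecI)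

text \<open>A step to a free neighbouring index cannot pass another entry.\<close>

lemma index_list_update:
  assumes ys: "index_list n r ys" and k: "k < r" and d: "d < n" "d \<notin> set ys"
    and adj: "d = Suc (ys ! k) \<or> ys ! k = Suc d"
  shows "index_list n r (ys[k := d])"
proof -
  have len: "length ys = r" and sorted: "\<And>i j. i < j \<Longrightarrow> j < r \<Longrightarrow> ys ! i < ys ! j"
    using ys by (auto simp: index_list_def sorted_wrt_iff_nth_less)
  have nd: "ys ! i \<noteq> d" if "i < r" for i
    using d that len by auto
  have upd: "ys[k := d] ! i = (if i = k then d else ys ! i)" if "i < r" for i
    using that len by (simp add: nth_list_update)
  have "sorted_wrt (<) (ys[k := d])"
    unfolding sorted_wrt_iff_nth_less
  proof (intro allI impI)
    fix i j assume ij: "i < j" "j < length (ys[k := d])"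
    then have "i < r" "j < r"
      using len by auto
    with ij show "ys[k := d] ! i < ys[k := d] ! j"
      using sorted[of i j] nd[of i] nd[of j] adj by (auto simp: upd)
  qed
  then show ?thesis
    using ys d set_update_subset_insert[of ys k d] by (auto simp: index_list_def)
qed

text \<open>The gain is \<open>a\<close> times the minor with \<open>c\<close> replaced by
  \<open>d\<close>. That minor vanishes if \<open>d\<close> already occurs in \<open>ys\<close>;
  otherwise its indices are still increasing, because \<open>c\<close> and \<open>d\<close> are
  adjacent.\<close>

lemma nonneg_minors_addcol:
  assumes M: "M \<in> carrier_mat n n" and tnn: "nonneg_minors n M" and a: "0 < a"
    and d: "d < n" and adj: "d = Suc c \<or> c = Suc d"
    and xs: "index_list n r xs" and ys: "index_list n r ys"
  shows "minor M xs ys \<le> minor (addcol a c d M) xs ys"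
proof (cases "c \<in> set ys")
  case True
  then obtain k where k: "k < r" "ys ! k = c"
    using ys by (auto simp: in_set_conv_nth index_list_def)
  have len: "length xs = r" "length ys = r"
    using xs ys by (simp_all add: index_list_def)
  have "0 \<le> minor M xs (ys[k := d])"
  proof (cases "d \<in> set ys")
    case True
    then obtain l where l: "l < r" "ys ! l = d"
      using len by (auto simp: in_set_conv_nth)
    with k adj have "l \<noteq> k" by auto
    then have "minor M xs (ys[k := d]) = 0"
      using len k l by (intro minor_repeated[of _ r _ k l]) auto
    then show ?thesis by simp
  next
    case False
    then have "index_list n r (ys[k := d])"
      using k adj d by (intro index_list_update[OF ys]) auto
    with tnn xs show ?thesis
      by (auto simp: nonneg_minors_def)
  qed
  with a show ?thesis
    by (simp add: minor_addcol[OF M xs ys k])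
qed (simp add: minor_addcol_notin[OF M xs ys])

lemma pos_minors_preserving_addrow_mat:
  assumes "0 < a" "d < n" "d = Suc c \<or> c = Suc d"
  shows "pos_minors_preserving n (addrow_mat n a d c)"
  unfolding pos_minors_preserving_def nonneg_minors_def
proof (intro conjI ballI impI allI)
  fix M r xs ys
  assume M: "M \<in> carrier_mat n n" and tnn: "\<forall>r xs ys. index_list n r xs \<longrightarrow> index_list n r ys \<longrightarrow> 0 \<le> minor M xs ys"
    and xs: "index_list n r xs" and ys: "index_list n r ys"
  have le: "minor M xs ys \<le> minor (M * addrow_mat n a d c) xs ys"
    using nonneg_minors_addcol[OF M _ assms xs ys] tnn M assms(2)
    by (simp add: addcol_mat[symmetric] nonneg_minors_def)
  then show "0 \<le> minor (M * addrow_mat n a d c) xs ys"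
    using tnn xs ys by (meson order.trans)
  assume "0 < minor M xs ys"
  with le show "0 < minor (M * addrow_mat n a d c) xs ys"
    by simp
qed simp

text \<open>The minor at the new columns becomes its old nonnegative value plus \<open>a\<close>
  times the positive minor at \<open>ys\<close>.\<close>

lemma minor_shift_column:
  assumes M: "M \<in> carrier_mat n n" and tnn: "nonneg_minors n M" and a: "0 < a"
    and d: "d < n"
    and xs: "index_list n r xs" and ys: "index_list n r ys" and zs: "index_list n r (ys[k := c])"
    and k: "k < r" "ys ! k = d"
    and pos: "0 < minor M xs ys"
  shows "0 < minor (M * addrow_mat n a d c) xs (ys[k := c])"
proof -
  have "length ys = r"
    using ys by (simp add: index_list_def)
  then have c: "ys[k := c] ! k = c" and "ys[k := c, k := d] = ys"
    using k by auto
  then have "minor (addcol a c d M) xs (ys[k := c]) = minor M xs (ys[k := c]) + a * minor M xs ys"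
    by (simp add: minor_addcol[OF M xs zs k(1) c])
  moreover have "0 \<le> minor M xs (ys[k := c])"
    using tnn xs zs by (auto simp: nonneg_minors_def)
  ultimately show ?thesis
    using M a d pos by (simp add: addcol_mat[symmetric] add_nonneg_pos)
qed

lemma mult_diagonal_entry:
  assumes "M \<in> carrier_mat n n" "D \<in> carrier_mat n n" "diagonal_mat D" "i < n" "j < n"
  shows "(M * D) $$ (i, j) = M $$ (i, j) * D $$ (j, j)"
proof -
  have "(M * D) $$ (i, j) = (\<Sum>k = 0..<n. M $$ (i, k) * D $$ (k, j))"
    using assms by (simp add: scalar_prod_def)
  also have "\<dots> = (\<Sum>k = 0..<n. if k = j then M $$ (i, j) * D $$ (j, j) else 0)"
    using assms by (intro sum.cong) (auto simp: diagonal_mat_def)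
  finally show ?thesis
    using assms by simp
qed

text \<open>The submatrix of \<open>M * D\<close> is that of \<open>M\<close> times a diagonal
  matrix of order \<open>r\<close>, so \<open>det_mult\<close> applies directly.\<close>

lemma minor_mult_diagonal:
  assumes M: "M \<in> carrier_mat n n" and D: "D \<in> carrier_mat n n" "diagonal_mat D"
    and xs: "index_list n r xs" and ys: "index_list n r ys"
  shows "minor (M * D) xs ys = minor M xs ys * (\<Prod>j = 0..<r. D $$ (ys ! j, ys ! j))"
proof -
  let ?M = "mat r r (\<lambda>(i, j). M $$ (xs ! i, ys ! j))"
  let ?D = "mat r r (\<lambda>(i, j). if i = j then D $$ (ys ! j, ys ! j) else 0)"
  have len: "length xs = r"
    using xs by (simp add: index_list_def)
  have "mat r r (\<lambda>(i, j). (M * D) $$ (xs ! i, ys ! j)) = ?M * ?D"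
  proof (rule eq_matI)
    fix i j assume "i < dim_row (?M * ?D)" "j < dim_col (?M * ?D)"
    then have ij: "i < r" "j < r" by auto
    have "(?M * ?D) $$ (i, j) = ?M $$ (i, j) * ?D $$ (j, j)"
      by (rule mult_diagonal_entry[where n = r]) (use ij in \<open>auto simp: diagonal_mat_def\<close>)
    then show "mat r r (\<lambda>(i, j). (M * D) $$ (xs ! i, ys ! j)) $$ (i, j) = (?M * ?D) $$ (i, j)"
      using ij mult_diagonal_entry[OF M D index_list_nth[OF xs ij(1)] index_list_nth[OF ys ij(2)]]
      by simp
  qed auto
  moreover have "det ?D = (\<Prod>j = 0..<r. D $$ (ys ! j, ys ! j))"
    by (subst det_upper_triangular[of _ r]) (auto simp: prod_list_diag_prod)
  ultimately show ?thesis
    by (simp add: minor_def len det_mult[of _ r])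
qed

lemma pos_minors_preserving_diagonal:
  assumes "positive_diagonal n D"
  shows "pos_minors_preserving n D"
proof -
  have D: "D \<in> carrier_mat n n" "diagonal_mat D" and pos: "\<And>i. i < n \<Longrightarrow> 0 < D $$ (i, i)"
    using assms by (auto simp: positive_diagonal_def)
  have prod: "0 < (\<Prod>j = 0..<r. D $$ (ys ! j, ys ! j))" if "index_list n r ys" for r ys
    using pos index_list_nth[OF that] by (intro prod_pos) auto
  show ?thesis
    unfolding pos_minors_preserving_def nonneg_minors_def
  proof (intro conjI ballI impI allI)
    fix M :: "real mat" and r xs ys
    assume M: "M \<in> carrier_mat n n" and xs: "index_list n r xs" and ys: "index_list n r ys"
    note eq = minor_mult_diagonal[OF M D xs ys]
    show "0 \<le> minor (M * D) xs ys"
      if "\<forall>r xs ys. index_list n r xs \<longrightarrow> index_list n r ys \<longrightarrow> 0 \<le> minor M xs ys"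
      unfolding eq using that xs ys prod[OF ys] by (intro mult_nonneg_nonneg) (auto intro: less_imp_le)
    show "0 < minor (M * D) xs ys" if "0 < minor M xs ys"
      unfolding eq using that prod[OF ys] by simp
  qed (rule D(1))
qed

lemma pos_minors_preserving_mult:
  assumes "pos_minors_preserving n E" "pos_minors_preserving n F"
  shows "pos_minors_preserving n (E * F)"
  unfolding pos_minors_preserving_def
proof (intro conjI ballI impI)
  have E: "E \<in> carrier_mat n n" and F: "F \<in> carrier_mat n n"
    using assms by (auto simp: pos_minors_preserving_def)
  then show "E * F \<in> carrier_mat n n" by simp
  fix M assume M: "M \<in> carrier_mat n n" "nonneg_minors n M"
  with E F have "M * (E * F) = (M * E) * F" "M * E \<in> carrier_mat n n"
    by (simp_all add: assoc_mult_mat[of _ n n _ n _ n])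
  then show "nonneg_minors n (M * (E * F))"
    "\<forall>r xs ys. index_list n r xs \<longrightarrow> index_list n r ys \<longrightarrow> 0 < minor M xs ys \<longrightarrow> 0 < minor (M * (E * F)) xs ys"
    using M assms unfolding pos_minors_preserving_def by metis+
qed

lemma pos_minors_preserving_one: "pos_minors_preserving n (1\<^sub>m n)"
  by (simp add: pos_minors_preserving_def)

section \<open>Minors of the identity; minors as determinants of submatrices\<close>

lemma minor_one_diag:
  assumes "index_list n r xs"
  shows "minor (1\<^sub>m n) xs xs = 1"
proof -
  have "mat r r (\<lambda>(i, j). 1\<^sub>m n $$ (xs ! i, xs ! j)) = (1\<^sub>m r :: real mat)"
    using index_list_nth[OF assms] index_list_distinct[OF assms] assms
    by (intro eq_matI) (auto simp: nth_eq_iff_index_eq index_list_def)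
  then show ?thesis
    using assms by (simp add: minor_def index_list_def)
qed

text \<open>Different index sets of equal size leave some index of \<open>ys\<close> outside
  \<open>xs\<close>; its column is zero.\<close>

lemma minor_one_off_diag:
  assumes xs: "index_list n r xs" and ys: "index_list n r ys" and "xs \<noteq> ys"
  shows "minor (1\<^sub>m n) xs ys = 0"
proof -
  have len: "length xs = r" "length ys = r"
    using xs ys by (simp_all add: index_list_def)
  have "set xs \<noteq> set ys"
    using assms strict_sorted_equal by (auto simp: index_list_def)
  moreover have "card (set xs) = card (set ys)"
    using len index_list_distinct[OF xs] index_list_distinct[OF ys] by (simp add: distinct_card)
  ultimately have "\<not> set ys \<subseteq> set xs"
    by (metis card_subset_eq finite_set)
  then obtain y where "y \<in> set ys" "y \<notin> set xs"
    by blast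
  then obtain k where k: "k < r" "ys ! k \<notin> set xs"
    using len by (metis in_set_conv_nth)
  let ?A = "mat r r (\<lambda>(i, j). 1\<^sub>m n $$ (xs ! i, ys ! j)) :: real mat"
  have "?A $$ (i, k) = 0" if "i < r" for i
  proof -
    have "xs ! i \<noteq> ys ! k"
      using k(2) nth_mem[of i xs] len that by metis
    then show ?thesis
      using k(1) that index_list_nth[OF xs that] index_list_nth[OF ys k(1)] by simp
  qed
  then have "det ?A = 0"
    by (subst laplace_expansion_column[of _ r k]) (auto simp: k)
  then show ?thesis
    by (simp add: minor_def len)
qed

lemma nonneg_minors_one: "nonneg_minors n (1\<^sub>m n)"
  unfolding nonneg_minors_def
  by (metis minor_one_diag minor_one_off_diag zero_le_one order_refl)

text \<open>\<open>pick K\<close> enumerates \<open>K\<close> increasingly; this links set-indexed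
  minors to list-indexed ones.\<close>

lemma submatrix_minor:
  assumes M: "M \<in> carrier_mat n n" and IJ: "I \<subseteq> {..<n}" "J \<subseteq> {..<n}" "card I = card J"
  obtains xs ys where "index_list n (card I) xs" "index_list n (card I) ys"
    "det (submatrix M I J) = minor M xs ys"
proof -
  have pick: "index_list n (card K) (map (pick K) [0..<card K])" if "K \<subseteq> {..<n}" for K
    using subsetD[OF that pick_in_set_le[of _ K]] pick_mono_le[of _ K]
    by (auto simp: index_list_def sorted_wrt_iff_nth_less)
  have dims: "{i. i < n \<and> i \<in> I} = I" "{i. i < n \<and> i \<in> J} = J"
    using IJ by auto
  have "submatrix M I J = mat (card I) (card I)
      (\<lambda>(i, j). M $$ (map (pick I) [0..<card I] ! i, map (pick J) [0..<card J] ! j))"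
    using M IJ by (auto simp: submatrix_def dims intro!: cong_mat)
  then show ?thesis
    using that[OF pick[OF IJ(1)], of "map (pick J) [0..<card J]"] pick[OF IJ(2)] IJ(3)
    by (simp add: minor_def)
qed

lemma totally_nonnegative_if_nonneg_minors:
  assumes "M \<in> carrier_mat n n" "nonneg_minors n M"
  shows "totally_nonnegative M"
  unfolding totally_nonnegative_def
proof (intro allI impI)
  fix I J assume "I \<subseteq> {..<dim_row M}" "J \<subseteq> {..<dim_col M}" and card: "card I = card J"
  with assms(1) have "I \<subseteq> {..<n}" "J \<subseteq> {..<n}" by auto
  from submatrix_minor[OF assms(1) this card] obtain xs ys
    where "index_list n (card I) xs" "index_list n (card I) ys" "det (submatrix M I J) = minor M xs ys" .
  with assms(2) show "0 \<le> det (submatrix M I J)"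
    by (auto simp: nonneg_minors_def)
qed

lemma totally_positive_if_pos_minors:
  assumes "M \<in> carrier_mat n n"
    and "\<And>r xs ys. index_list n r xs \<Longrightarrow> index_list n r ys \<Longrightarrow> 0 < minor M xs ys"
  shows "totally_positive M"
  unfolding totally_positive_def
proof (intro allI impI)
  fix I J assume "I \<subseteq> {..<dim_row M}" "J \<subseteq> {..<dim_col M}" and card: "card I = card J"
  with assms(1) have "I \<subseteq> {..<n}" "J \<subseteq> {..<n}" by auto
  from submatrix_minor[OF assms(1) this card] obtain xs ys
    where "index_list n (card I) xs" "index_list n (card I) ys" "det (submatrix M I J) = minor M xs ys" .
  with assms(2) show "0 < det (submatrix M I J)"
    by auto
qed

lemma totally_positive_entry:
  assumes "M \<in> carrier_mat n n" "totally_positive M" "i < n" "j < n"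
  shows "0 < M $$ (i, j)"
proof -
  have "0 < det (submatrix M {i} {j})"
    using assms by (auto simp: totally_positive_def)
  moreover have "{k. k < n \<and> k = i} = {i}" "{k. k < n \<and> k = j} = {j}"
    using assms by auto
  then have "submatrix M {i} {j} = mat 1 1 (\<lambda>_. M $$ (i, j))"
    using assms pick_in_set_le[of 0 "{i}"] pick_in_set_le[of 0 "{j}"]
    by (intro eq_matI) (simp_all add: submatrix_def del: pick.simps)
  ultimately show ?thesis
    by (simp add: det_single)
qed

section \<open>Moves between index lists and positivity of powers\<close>

definition move :: "nat \<Rightarrow> nat list \<Rightarrow> nat list \<Rightarrow> bool" where
  "move n ys zs \<longleftrightarrow> (\<exists>k d. k < length ys \<and> zs = ys[k := d] \<and> (d = Suc (ys ! k) \<or> ys ! k = Suc d) \<and>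
     index_list n (length ys) ys \<and> index_list n (length ys) zs)"

lemma move_sym: "move n ys zs \<Longrightarrow> move n zs ys"
  unfolding move_def by (metis length_list_update list_update_id list_update_overwrite nth_list_update_eq)

text \<open>As long as the list differs from \<open>[0..<r]\<close>, some entry can be lowered by
  one, which decreases the sum.\<close>

lemma moves_to_initial:
  "index_list n r ys \<Longrightarrow> (move n)\<^sup>*\<^sup>* ys [0..<r]"
proof (induction "sum_list ys" arbitrary: ys rule: less_induct)
  case less
  have len: "length ys = r" and sorted: "\<And>i j. i < j \<Longrightarrow> j < r \<Longrightarrow> ys ! i < ys ! j"
    using less.prems by (auto simp: index_list_def sorted_wrt_iff_nth_less)
  show ?case
  proof (cases "ys = [0..<r]")
    case False
    then have ex: "\<exists>k. k < r \<and> ys ! k \<noteq> k"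
      using len by (auto intro: nth_equalityI)
    \<comment> \<open>The first displaced entry is the one to lower.\<close>
    define k where "k = (LEAST k. k < r \<and> ys ! k \<noteq> k)"
    have k: "k < r" "ys ! k \<noteq> k"
      using LeastI_ex[OF ex] by (simp_all add: k_def)
    have min: "ys ! i = i" if "i < k" for i
      using not_less_Least[of i "\<lambda>k. k < r \<and> ys ! k \<noteq> k"] that k(1) by (auto simp: k_def)
    \<comment> \<open>A smaller value \<open>ys ! k\<close> would already stand at position
      \<open>ys ! k\<close>, against strict monotonicity.\<close>
    have "k < ys ! k"
      using sorted[of "ys ! k" k] min[of "ys ! k"] k by (cases k "ys ! k" rule: linorder_cases) auto
    then obtain d where d: "ys ! k = Suc d" "k \<le> d"
      by (cases "ys ! k") auto
    \<comment> \<open>Earlier entries are below \<open>k \<le> d\<close>, later ones above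
      \<open>ys ! k = Suc d\<close>.\<close>
    have "d \<notin> set ys"
    proof
      assume "d \<in> set ys"
      then obtain i where "i < r" "ys ! i = d"
        using len by (auto simp: in_set_conv_nth)
      with d k min[of i] sorted[of k i] show False
        by (cases i k rule: linorder_cases) auto
    qed
    moreover have "d < n"
      using index_list_nth[OF less.prems k(1)] d by simp
    ultimately have upd: "index_list n r (ys[k := d])"
      using d k by (intro index_list_update[OF less.prems]) auto
    have "sum_list (ys[k := d]) < sum_list ys"
      using k d len sum_list_update[of k ys d] member_le_sum_list[of "ys ! k" ys] nth_mem[of k ys] by simp
    from less.hyps[OF this upd] have "(move n)\<^sup>*\<^sup>* (ys[k := d]) [0..<r]" .
    moreover have "move n ys (ys[k := d])"
      unfolding move_def using k d len less.prems upd by blast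
    ultimately show ?thesis
      by (rule converse_rtranclp_into_rtranclp[rotated])
  qed simp
qed

lemma moves_connected:
  assumes "index_list n r xs" "index_list n r ys"
  shows "(move n)\<^sup>*\<^sup>* xs ys"
proof -
  have "(move n)\<^sup>*\<^sup>* [0..<r] ys"
    using moves_to_initial[OF assms(2)] move_sym
    by (metis symp_def symp_rtranclp)
  with moves_to_initial[OF assms(1)] show ?thesis by simp
qed

lemma pos_minors_preserving_pow:
  assumes "pos_minors_preserving n A"
  shows "A ^\<^sub>m k \<in> carrier_mat n n" "nonneg_minors n (A ^\<^sub>m k)"
proof -
  have A: "A \<in> carrier_mat n n"
    using assms by (simp add: pos_minors_preserving_def)
  then show C: "A ^\<^sub>m k \<in> carrier_mat n n" for k by simp
  show "nonneg_minors n (A ^\<^sub>m k)"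
    by (induction k) (use A C assms in \<open>auto simp: nonneg_minors_one pos_minors_preserving_def\<close>)
qed

text \<open>Each factor \<open>A\<close> permits one move and destroys no positive minor, so a minor
  is positive once the exponent reaches the number of moves between its index lists. Finitely many
  minors share an exponent.\<close>

lemma oscillatory_if_moves:
  assumes A: "pos_minors_preserving n A"
    and moves: "\<And>M r xs ys zs. M \<in> carrier_mat n n \<Longrightarrow> nonneg_minors n M \<Longrightarrow>
      index_list n r xs \<Longrightarrow> index_list n r ys \<Longrightarrow> 0 < minor M xs ys \<Longrightarrow> move n ys zs \<Longrightarrow>
      0 < minor (M * A) xs zs"
  shows "oscillatory A"
proof -
  have carr: "A \<in> carrier_mat n n"
    using A by (simp add: pos_minors_preserving_def)
  have step: "\<forall>\<^sub>F k in sequentially. 0 < minor (A ^\<^sub>m k) xs ys"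
    if xs: "index_list n r xs" and path: "(move n)\<^sup>*\<^sup>* xs ys" for r xs ys
    using path
  proof (induction rule: rtranclp_induct)
    case base
    \<comment> \<open>Positivity for all exponents, not just for 0, lets paths of different lengths
      end in a common exponent.\<close>
    have "0 < minor (A ^\<^sub>m k) xs xs" for k
    proof (induction k)
      case 0
      then show ?case using carr by (simp add: minor_one_diag[OF xs])
    next
      case (Suc k)
      then show ?case
        using A xs pos_minors_preserving_pow[OF A, of k] by (auto simp: pos_minors_preserving_def)
    qed
    then show ?case by simp
  next
    case (step ys zs)
    have "length ys = r"
      using step.hyps(1) xs
      by (induction rule: rtranclp_induct) (auto simp: move_def index_list_def)
    then have ys: "index_list n r ys"
      using step.hyps(2) by (auto simp: move_def)
    \<comment> \<open>One move costs one more factor \<open>A\<close>.\<close>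
    from step.IH have "\<forall>\<^sub>F k in sequentially. 0 < minor (A ^\<^sub>m Suc k) xs zs"
      by eventually_elim
        (use moves[OF pos_minors_preserving_pow[OF A] xs ys _ step.hyps(2)] in simp)
    then show ?case
      by (rule eventually_sequentially_Suc[of "\<lambda>k. 0 < minor (A ^\<^sub>m k) xs zs", THEN iffD1])
  qed
  \<comment> \<open>A finite set containing the index lists of all sizes, to make the exponent
    uniform.\<close>
  define S where "S = {xs. set xs \<subseteq> {..<n} \<and> length xs \<le> n}"
  have S: "finite S" "\<And>r xs. index_list n r xs \<Longrightarrow> xs \<in> S"
    using finite_lists_length_le[of "{..<n}" n] index_list_length_le
    by (auto simp: S_def index_list_def)
  have "\<forall>\<^sub>F k in sequentially. \<forall>xs\<in>S. \<forall>ys\<in>S. \<forall>r. index_list n r xs \<longrightarrow> index_list n r ys \<longrightarrow>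
      0 < minor (A ^\<^sub>m k) xs ys"
  proof (intro eventually_ball_finite S ballI)
    fix xs ys
    show "\<forall>\<^sub>F k in sequentially. \<forall>r. index_list n r xs \<longrightarrow> index_list n r ys \<longrightarrow>
      0 < minor (A ^\<^sub>m k) xs ys"
    proof (cases "\<exists>r. index_list n r xs \<and> index_list n r ys")
      case True
      then obtain r where "index_list n r xs" "index_list n r ys" by blast
      from step[OF this(1) moves_connected[OF this]] show ?thesis
        by (rule eventually_mono) auto
    qed auto
  qed
  from eventually_conj[OF this eventually_gt_at_top[of 0]]
  obtain k where "0 < k" and k: "\<And>r xs ys. index_list n r xs \<Longrightarrow> index_list n r ys \<Longrightarrow>
      0 < minor (A ^\<^sub>m k) xs ys"
    using S(2) by (auto dest!: eventually_happens simp: trivial_limit_sequentially)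
  have "totally_positive (A ^\<^sub>m k)"
    using pos_minors_preserving_pow(1)[OF A] k by (rule totally_positive_if_pos_minors)
  moreover have "nonneg_minors n A"
    using pos_minors_preserving_pow(2)[OF A, of 1] carr by simp
  then have "totally_nonnegative A"
    by (rule totally_nonnegative_if_nonneg_minors[OF carr])
  ultimately show ?thesis
    using \<open>0 < k\<close> carr by (auto simp: oscillatory_def)
qed

section \<open>Products of elementary factors\<close>

lemma elem_factor_carrier [simp]: "elem_factor n c a \<in> carrier_mat n n"
  by (simp add: elem_factor_def mat_unit_def)

text \<open>Letters count from 1 and matrix indices from 0, so letter \<open>c\<close> couples the
  indices \<open>c - 1\<close> and \<open>c\<close>.\<close>

lemma elem_factor_addrow_mat:
  "1 \<le> c \<Longrightarrow> elem_factor n c a = addrow_mat n a (c - 1) c"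
  by (intro eq_matI) (auto simp: elem_factor_def mat_unit_def addrow_mat_def)

lemma transpose_elem_factor:
  "1 \<le> c \<Longrightarrow> transpose_mat (elem_factor n c a) = addrow_mat n a c (c - 1)"
  by (intro eq_matI) (auto simp: elem_factor_def mat_unit_def addrow_mat_def)

lemma U_mat_Nil [simp]: "U_mat n [] [] = 1\<^sub>m n"
  by (simp add: U_mat_def)

lemma U_mat_Cons [simp]: "U_mat n (c # w) (a # as) = elem_factor n c a * U_mat n w as"
  by (simp add: U_mat_def)

lemma U_mat_carrier: "length w = length as \<Longrightarrow> U_mat n w as \<in> carrier_mat n n"
  by (induction w as rule: list_induct2) (auto intro: mult_carrier_mat[of _ n n _ n])

lemma U_mat_append:
  assumes "length u = length as" "length v = length bs"
  shows "U_mat n (u @ v) (as @ bs) = U_mat n u as * U_mat n v bs"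
  using assms
proof (induction u as rule: list_induct2)
  case Nil
  then show ?case using U_mat_carrier[of v bs n] by simp
next
  case (Cons c u a as)
  then show ?case
    using U_mat_carrier[of u as n] U_mat_carrier[of v bs n]
    by (simp add: assoc_mult_mat[of _ n n _ n _ n])
qed

lemma U_mat_entry_Cons:
  assumes "length w = length as" "1 \<le> c" "c < n" "i < n" "j < n"
  shows "U_mat n (c # w) (a # as) $$ (i, j) =
    (if Suc i = c then a * U_mat n w as $$ (Suc i, j) else 0) + U_mat n w as $$ (i, j)"
proof -
  have "U_mat n (c # w) (a # as) = addrow a (c - 1) c (U_mat n w as)"
    using assms U_mat_carrier[of w as n] addrow_mat[of "U_mat n w as" n n c a "c - 1"]
    by (simp add: elem_factor_addrow_mat)
  then show ?thesis
    using assms U_mat_carrier[of w as n] by auto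
qed

text \<open>The zero-based entry \<open>(i, j)\<close> belongs to the letters
  \<open>i + 1, ..., j\<close>. Prepending \<open>c\<close> changes row \<open>c - 1\<close> only,
  just as only a run starting with \<open>c\<close> can use the new letter; all terms are
  nonnegative, so none cancel. Below the diagonal the interval is empty, hence the condition
  \<open>i \<le> j\<close>.\<close>

lemma U_mat_entries:
  assumes "length w = length as" "set w \<subseteq> {1..n - 1}" "\<forall>a\<in>set as. 0 < a" "i < n" "j < n"
  shows "0 \<le> U_mat n w as $$ (i, j) \<and>
    (U_mat n w as $$ (i, j) \<noteq> 0 \<longleftrightarrow> i \<le> j \<and> subseq [Suc i..<Suc j] w)"
  using assms
proof (induction w as arbitrary: i rule: list_induct2)
  case Nil
  then show ?case by (auto simp: upt_eq_Nil_conv)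
next
  case (Cons c w a as)
  have c: "1 \<le> c" "c < n" "0 < a"
    using Cons.prems by auto
  have 1: "0 \<le> U_mat n w as $$ (i, j) \<and>
      (U_mat n w as $$ (i, j) \<noteq> 0 \<longleftrightarrow> i \<le> j \<and> subseq [Suc i..<Suc j] w)"
    using Cons.prems by (intro Cons.IH) auto
  note eq = U_mat_entry_Cons[OF Cons.hyps c(1,2) Cons.prems(3,4), of a]
  show ?case
  proof (cases "Suc i = c")
    case True
    have 2: "0 \<le> U_mat n w as $$ (Suc i, j) \<and>
        (U_mat n w as $$ (Suc i, j) \<noteq> 0 \<longleftrightarrow> Suc i \<le> j \<and> subseq [Suc (Suc i)..<Suc j] w)"
      using Cons.prems True c by (intro Cons.IH) auto
    \<comment> \<open>\<open>subseq\<close> matches \<open>c\<close> greedily and leaves the tail; a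
      run inside \<open>w\<close> has its tail there too, so the two disjuncts mirror the two
      summands.\<close>
    have "subseq [Suc i..<Suc j] (c # w) \<longleftrightarrow>
        subseq [Suc i..<Suc j] w \<or> subseq [Suc (Suc i)..<Suc j] w" if "i < j"
      using that True by (subst (1 2) upt_conv_Cons) (auto dest: subseq_Cons')
    moreover have "[Suc i..<Suc j] = []" if "\<not> i < j"
      using that by simp
    moreover have "0 \<le> a * U_mat n w as $$ (Suc i, j)"
      using 2 c by simp
    ultimately show ?thesis
      unfolding eq using 1 2 c True by (cases "i < j") (auto simp: add_nonneg_eq_0_iff simp del: upt_Suc)
  next
    case False
    then have "subseq [Suc i..<Suc j] (c # w) \<longleftrightarrow> subseq [Suc i..<Suc j] w"
      by (cases "i < j") (auto simp: upt_conv_Cons simp del: upt_Suc)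
    then show ?thesis
      unfolding eq using 1 False by simp
  qed
qed

text \<open>Conjugation by the diagonal matrix of alternating signs turns \<open>x_c(a)\<close> into
  \<open>x_c(-a)\<close>, as neighbouring indices have opposite signs.\<close>

lemma U_mat_uminus:
  assumes "length w = length as" "set w \<subseteq> {1..n - 1}" "i < n" "j < n"
  shows "U_mat n w (map uminus as) $$ (i, j) = (-1) ^ (i + j) * U_mat n w as $$ (i, j)"
  using assms
proof (induction w as arbitrary: i rule: list_induct2)
  case Nil
  then show ?case by (auto simp: power_add[symmetric])
next
  case (Cons c w a as)
  have c: "1 \<le> c" "c < n"
    using Cons.prems by auto
  have "U_mat n w (map uminus as) $$ (k, j) = (-1) ^ (k + j) * U_mat n w as $$ (k, j)" if "k < n" for k
    using Cons.prems that by (intro Cons.IH) auto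
  then show ?case
    using Cons.prems Cons.hyps c
    by (auto simp: U_mat_entry_Cons algebra_simps simp del: U_mat_Cons)
qed

text \<open>\<open>x_c(a)\<close> has inverse \<open>x_c(-a)\<close>, and inversion reverses
  products.\<close>

lemma U_mat_inverse:
  assumes "length w = length as" "set w \<subseteq> {1..n - 1}"
  shows "U_mat n w as * U_mat n (rev w) (map uminus (rev as)) = 1\<^sub>m n"
  using assms
proof (induction w as rule: list_induct2)
  case (Cons c w a as)
  let ?x = "elem_factor n c a" and ?y = "elem_factor n c (- a)"
  let ?U = "U_mat n w as" and ?V = "U_mat n (rev w) (map uminus (rev as))"
  have carr: "?U \<in> carrier_mat n n" "?V \<in> carrier_mat n n"
    using Cons.hyps by (auto intro!: U_mat_carrier)
  have "?x * ?y = 1\<^sub>m n"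
    using Cons.prems addrow_mat_inv[of "c - 1" n c "a"] by (auto simp: elem_factor_addrow_mat)
  moreover have "U_mat n (rev (c # w)) (map uminus (rev (a # as))) = ?V * ?y"
    using Cons.hyps right_mult_one_mat[of ?y n n] by (simp add: U_mat_append)
  moreover have "(?x * ?U) * (?V * ?y) = ?x * (?U * ?V) * ?y"
    using carr by (simp add: assoc_mult_mat[of _ n n _ n _ n] mult_carrier_mat[of _ n n _ n])
  ultimately show ?case
    using Cons right_mult_one_mat[of ?x n n] by simp
qed simp

lemma U_mat_pos_minors_preserving:
  assumes "set w \<subseteq> {1..n - 1}" "length w = length as" "\<forall>a\<in>set as. 0 < a"
  shows "pos_minors_preserving n (U_mat n w as)"
    and "pos_minors_preserving n (transpose_mat (U_mat n w as))"
proof -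
  have "pos_minors_preserving n (U_mat n w as) \<and> pos_minors_preserving n (transpose_mat (U_mat n w as))"
    using assms(2,1,3)
  proof (induction w as rule: list_induct2)
    case (Cons c w a as)
    have c: "1 \<le> c" "c < n" "0 < a"
      using Cons.prems by auto
    have "pos_minors_preserving n (elem_factor n c a)"
      unfolding elem_factor_addrow_mat[OF c(1)] using c by (intro pos_minors_preserving_addrow_mat) auto
    moreover have "pos_minors_preserving n (transpose_mat (elem_factor n c a))"
      unfolding transpose_elem_factor[OF c(1)] using c by (intro pos_minors_preserving_addrow_mat) auto
    ultimately show ?case
      using Cons U_mat_carrier[OF Cons.hyps, of n]
      by (auto simp: transpose_mult[of _ n n _ n] intro!: pos_minors_preserving_mult)
  qed (simp add: pos_minors_preserving_one)
  then show "pos_minors_preserving n (U_mat n w as)"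
    "pos_minors_preserving n (transpose_mat (U_mat n w as))"
    by auto
qed

text \<open>The first factor with letter \<open>Suc (ys ! k)\<close> makes the shift. Factors before
  it keep the minor at \<open>ys\<close> positive, those after it the shifted one.\<close>

lemma U_mat_minor_up:
  assumes "length w = length as" "set w \<subseteq> {1..n - 1}" "\<forall>a\<in>set as. 0 < a"
    and "Suc (ys ! k) \<in> set w" and "k < r"
    and "index_list n r xs" "index_list n r ys" "index_list n r (ys[k := Suc (ys ! k)])"
    and "M \<in> carrier_mat n n" "nonneg_minors n M" "0 < minor M xs ys"
  shows "0 < minor (M * U_mat n w as) xs (ys[k := Suc (ys ! k)])"
  using assms
proof (induction w as arbitrary: M rule: list_induct2)
  case (Cons c w a as)
  let ?x = "elem_factor n c a" and ?zs = "ys[k := Suc (ys ! k)]"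
  have c: "1 \<le> c" "c < n" "0 < a"
    using Cons.prems by auto
  have x: "pos_minors_preserving n ?x"
    using c by (auto simp: elem_factor_addrow_mat intro!: pos_minors_preserving_addrow_mat)
  have Mx: "M * ?x \<in> carrier_mat n n" "nonneg_minors n (M * ?x)"
    using x Cons.prems by (auto simp: pos_minors_preserving_def)
  have "0 < minor ((M * ?x) * U_mat n w as) xs ?zs"
  proof (cases "Suc (ys ! k) = c")
    case True
    have "0 < minor (M * ?x) xs ?zs"
      using minor_shift_column[of M n a "c - 1" r xs ys k c] Cons.prems c True
      by (auto simp: elem_factor_addrow_mat)
    moreover have "pos_minors_preserving n (U_mat n w as)"
      using Cons.prems Cons.hyps by (intro U_mat_pos_minors_preserving) auto
    ultimately show ?thesis
      using Mx Cons.prems unfolding pos_minors_preserving_def by blast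
  next
    case False
    moreover have "0 < minor (M * ?x) xs ys"
      using x Cons.prems unfolding pos_minors_preserving_def by blast
    ultimately show ?thesis
      using Mx Cons.prems by (intro Cons.IH) auto
  qed
  then show ?case
    using Cons.prems U_mat_carrier[OF Cons.hyps, of n]
    by (simp add: assoc_mult_mat[of M n n ?x n _ n])
qed simp

text \<open>Transposition reverses the product, so the factor of the first letter acts last. A
  factor with letter \<open>ys ! k\<close> lowers the index; the others preserve positivity.\<close>

lemma U_mat_minor_down:
  assumes "length w = length as" "set w \<subseteq> {1..n - 1}" "\<forall>a\<in>set as. 0 < a"
    and "ys ! k \<in> set w" "ys ! k = Suc d" and "k < r"
    and "index_list n r xs" "index_list n r ys" "index_list n r (ys[k := d])"
    and "M \<in> carrier_mat n n" "nonneg_minors n M" "0 < minor M xs ys"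
  shows "0 < minor (M * transpose_mat (U_mat n w as)) xs (ys[k := d])"
  using assms
proof (induction w as rule: list_induct2)
  case (Cons c w a as)
  let ?x = "transpose_mat (elem_factor n c a)" and ?zs = "ys[k := d]"
  let ?U = "transpose_mat (U_mat n w as)"
  have c: "1 \<le> c" "c < n" "0 < a"
    using Cons.prems by auto
  have x: "pos_minors_preserving n ?x"
    using c by (auto simp: transpose_elem_factor intro!: pos_minors_preserving_addrow_mat)
  have U: "pos_minors_preserving n ?U"
    using Cons.prems Cons.hyps by (intro U_mat_pos_minors_preserving) auto
  have MU: "M * ?U \<in> carrier_mat n n" "nonneg_minors n (M * ?U)"
    using U Cons.prems by (auto simp: pos_minors_preserving_def)
  have "0 < minor ((M * ?U) * ?x) xs ?zs"
  proof (cases "ys ! k = c")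
    case True
    have "0 < minor (M * ?U) xs ys"
      using U Cons.prems unfolding pos_minors_preserving_def by blast
    then show ?thesis
      using minor_shift_column[of "M * ?U" n a c r xs ys k d] MU Cons.prems c True
      by (auto simp: transpose_elem_factor)
  next
    case False
    then have "0 < minor (M * ?U) xs ?zs"
      using Cons.prems by (intro Cons.IH) auto
    then show ?thesis
      using x MU Cons.prems unfolding pos_minors_preserving_def by blast
  qed
  then show ?case
    using Cons.prems U_mat_carrier[OF Cons.hyps, of n]
    by (simp add: transpose_mult[of _ n n _ n] assoc_mult_mat[of M n n ?U n _ n])
qed simp

section \<open>Entries and bandwidth of symmetric products\<close>

lemma gram_entry:
  assumes M: "M \<in> carrier_mat n n" and D: "D \<in> carrier_mat n n" "diagonal_mat D" and ij: "i < n" "j < n"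
  shows "(transpose_mat M * D * M) $$ (i, j) = (\<Sum>k<n. M $$ (k, i) * D $$ (k, k) * M $$ (k, j))"
proof -
  have "(transpose_mat M * D * M) $$ (i, j) = (\<Sum>k = 0..<n. (transpose_mat M * D) $$ (i, k) * M $$ (k, j))"
    using assms by (subst index_mult_mat) (auto simp: scalar_prod_def)
  also have "\<dots> = (\<Sum>k<n. M $$ (k, i) * D $$ (k, k) * M $$ (k, j))"
    unfolding lessThan_atLeast0
  proof (rule sum.cong)
    fix k assume "k \<in> {0..<n}"
    then have "(transpose_mat M * D) $$ (i, k) = M $$ (k, i) * D $$ (k, k)"
      using mult_diagonal_entry[of "transpose_mat M" n D i k] M D ij by simp
    then show "(transpose_mat M * D) $$ (i, k) * M $$ (k, j) = M $$ (k, i) * D $$ (k, k) * M $$ (k, j)"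
      by simp
  qed simp
  finally show ?thesis .
qed

lemma bw_ge:
  assumes "i < dim_row C" "j < dim_col C" "C $$ (i, j) \<noteq> 0"
  shows "j - i \<le> bw C"
proof -
  let ?S = "{nat \<bar>int i - int j\<bar> | i j. i < dim_row C \<and> j < dim_col C \<and> C $$ (i, j) \<noteq> 0}"
  have "?S \<subseteq> (\<lambda>(i, j). nat \<bar>int i - int j\<bar>) ` ({..<dim_row C} \<times> {..<dim_col C})"
    by auto
  then have "finite ?S"
    by (rule finite_subset) auto
  then have "nat \<bar>int i - int j\<bar> \<le> bw C"
    unfolding bw_def using assms by (intro Max_ge) auto
  then show ?thesis by linarith
qed

lemma bw_le:
  assumes "\<And>i j. i < dim_row C \<Longrightarrow> j < dim_col C \<Longrightarrow> C $$ (i, j) \<noteq> 0 \<Longrightarrow> nat \<bar>int i - int j\<bar> \<le> l"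
  shows "bw C \<le> l"
proof -
  let ?S = "{nat \<bar>int i - int j\<bar> | i j. i < dim_row C \<and> j < dim_col C \<and> C $$ (i, j) \<noteq> 0}"
  have "?S \<subseteq> {..l}"
    using assms by auto
  moreover from this have "finite ?S"
    by (rule finite_subset) auto
  ultimately show ?thesis
    unfolding bw_def by (subst Max_le_iff) auto
qed

text \<open>A nonzero entry of \<open>A\<close> yields a run that may start further left, one of its
  inverse a run that may end further right. Hence the covering run in the second condition on
  \<open>C\<close>; covering runs have the same maximal length.\<close>

lemma bw_eq_longest_run:
  assumes C: "C \<in> carrier_mat n n" and n: "1 \<le> n" and w: "set w \<subseteq> {1..n - 1}"
    and sym: "\<And>i j. i < n \<Longrightarrow> j < n \<Longrightarrow> C $$ (i, j) = C $$ (j, i)"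
    and nz: "\<And>i j. i \<le> j \<Longrightarrow> j < n \<Longrightarrow> C $$ (i, j) \<noteq> 0 \<Longrightarrow>
      \<exists>i' j'. i' \<le> i \<and> j \<le> j' \<and> subseq [Suc i'..<Suc j'] w"
    and run: "\<And>i j. i \<le> j \<Longrightarrow> j < n \<Longrightarrow> subseq [Suc i..<Suc j] w \<Longrightarrow> C $$ (i, j) \<noteq> 0"
  shows "bw C = longest_run w"
proof (rule antisym)
  have le: "j - i \<le> longest_run w" if ij: "i \<le> j" "j < n" "C $$ (i, j) \<noteq> 0" for i j
  proof -
    from nz[OF ij] obtain i' j' where "i' \<le> i" "j \<le> j'" "subseq [Suc i'..<Suc j'] w"
      by blast
    with longest_run_ge[OF this(3)] show ?thesis by linarith
  qed
  show "bw C \<le> longest_run w"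
  proof (rule bw_le)
    fix i j assume "i < dim_row C" "j < dim_col C" "C $$ (i, j) \<noteq> 0"
    with C have ij: "i < n" "j < n" "C $$ (i, j) \<noteq> 0" "C $$ (j, i) \<noteq> 0"
      using sym by auto
    show "nat \<bar>int i - int j\<bar> \<le> longest_run w"
    proof (cases "i \<le> j")
      case True
      with le[of i j] ij show ?thesis by linarith
    next
      case False
      with le[of j i] ij show ?thesis by linarith
    qed
  qed
  obtain i where i: "subseq [i..<i + longest_run w] w"
    using longest_run_attained by blast
  show "longest_run w \<le> bw C"
  proof (cases "longest_run w")
    case (Suc l)
    with i have sub: "subseq [i..<i + Suc l] w" by simp
    note b = run_bounds[OF this w]
    \<comment> \<open>The run \<open>i, ..., i + l\<close> belongs to this zero-based entry, at
      distance \<open>l + 1\<close> from the diagonal.\<close>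
    have "C $$ (i - 1, i + l) \<noteq> 0"
      using b n sub by (intro run) auto
    then have "i + l - (i - 1) \<le> bw C"
      using b n C by (intro bw_ge) auto
    with b Suc show ?thesis by simp
  qed simp
qed

lemma U_mat_pos_iff:
  assumes "length w = length as" "set w \<subseteq> {1..n - 1}" "\<forall>a\<in>set as. 0 < a" "i < n" "j < n"
  shows "0 < U_mat n w as $$ (i, j) \<longleftrightarrow> i \<le> j \<and> subseq [Suc i..<Suc j] w"
  using U_mat_entries[OF assms] by auto

section \<open>A fixed factorization: oscillation and both bandwidths\<close>

locale symmetric_factorization =
  fixes n :: nat and w :: "nat list" and as :: "real list" and D :: "real mat"
  assumes n: "1 \<le> n" and letters: "set w \<subseteq> {1..n - 1}" and len: "length w = length as"
    and pos: "\<forall>a\<in>set as. 0 < a" and D: "positive_diagonal n D"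
begin

abbreviation "U \<equiv> U_mat n w as"
text \<open>\<open>V\<close>, \<open>D'\<close> and \<open>B\<close> are the inverses of
  \<open>U\<close>, \<open>D\<close> and \<open>A\<close>.\<close>

abbreviation "V \<equiv> U_mat n (rev w) (map uminus (rev as))"
abbreviation "A \<equiv> transpose_mat U * D * U"
abbreviation "D' \<equiv> mat n n (\<lambda>(i, j). if i = j then 1 / D $$ (i, i) else 0)"
abbreviation "B \<equiv> V * D' * transpose_mat V"

lemma carriers: "U \<in> carrier_mat n n" "V \<in> carrier_mat n n" "D \<in> carrier_mat n n" "D' \<in> carrier_mat n n"
  using len D by (auto intro!: U_mat_carrier simp: positive_diagonal_def)

lemma A_pos_minors_preserving: "pos_minors_preserving n A"
  using U_mat_pos_minors_preserving[OF letters len pos] D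
  by (intro pos_minors_preserving_mult pos_minors_preserving_diagonal[OF D])

text \<open>\<open>U\<close> raises a column index and its transpose lowers one; the remaining
  factors keep the minor positive.\<close>

lemma oscillatory_if_all_letters:
  assumes all: "{1..n - 1} \<subseteq> set w"
  shows "oscillatory A"
  using A_pos_minors_preserving
proof (rule oscillatory_if_moves)
  fix M r xs ys zs
  assume M: "M \<in> carrier_mat n n" "nonneg_minors n M" and xs: "index_list n r xs"
    and ys: "index_list n r ys" and p: "0 < minor M xs ys" and "move n ys zs"
  then obtain k d where k: "k < r" and zs: "zs = ys[k := d]" "index_list n r zs"
    and d: "d = Suc (ys ! k) \<or> ys ! k = Suc d"
    by (auto simp: move_def index_list_def)
  have zk: "zs ! k = d"
    using k zs ys by (auto simp: index_list_def)
  have bounds: "ys ! k < n" "d < n"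
    using index_list_nth[OF ys k] index_list_nth[OF zs(2) k] zk by auto
  note U = U_mat_pos_minors_preserving[OF letters len pos] pos_minors_preserving_diagonal[OF D]
  have UD: "pos_minors_preserving n (D * U)" "pos_minors_preserving n (transpose_mat U * D)"
    using U by (auto intro: pos_minors_preserving_mult)
  \<comment> \<open>The factor that makes the move is isolated: \<open>U\<close> for a step up, its
    transpose for a step down.\<close>
  have eq: "M * A = (M * (transpose_mat U * D)) * U" "M * A = (M * transpose_mat U) * (D * U)"
    using M carriers by (simp_all add: assoc_mult_mat[of _ n n _ n _ n] mult_carrier_mat[of _ n n _ n])
  from d show "0 < minor (M * A) xs zs"
  proof
    assume d: "d = Suc (ys ! k)"
    have "M * (transpose_mat U * D) \<in> carrier_mat n n" "nonneg_minors n (M * (transpose_mat U * D))"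
      "0 < minor (M * (transpose_mat U * D)) xs ys"
      using UD(2) M xs ys p carriers unfolding pos_minors_preserving_def by (blast intro: mult_carrier_mat)+
    moreover have "Suc (ys ! k) \<in> set w"
      using d bounds by (intro subsetD[OF all]) auto
    ultimately show ?thesis
      unfolding eq(1) zs(1) d
      using zs d by (intro U_mat_minor_up[OF len letters pos _ k xs ys]) auto
  next
    assume d: "ys ! k = Suc d"
    have "ys ! k \<in> set w"
      using d bounds by (intro subsetD[OF all]) auto
    then have "0 < minor (M * transpose_mat U) xs zs"
      unfolding zs(1) using zs M p by (intro U_mat_minor_down[OF len letters pos _ d k xs ys]) auto
    moreover have "M * transpose_mat U \<in> carrier_mat n n" "nonneg_minors n (M * transpose_mat U)"
      using U(2) M unfolding pos_minors_preserving_def by (blast intro: mult_carrier_mat)+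
    ultimately show ?thesis
      unfolding eq(2) using UD(1) xs zs unfolding pos_minors_preserving_def by blast
  qed
qed

text \<open>Only the letter \<open>c\<close> couples the indices below \<open>c\<close> with the
  others. Without it all powers of \<open>A\<close> are block diagonal, whereas a totally positive
  matrix has no zero entry.\<close>

lemma all_letters_if_oscillatory:
  assumes "oscillatory A"
  shows "{1..n - 1} \<subseteq> set w"
proof (rule ccontr)
  assume "\<not> {1..n - 1} \<subseteq> set w"
  then obtain c where c: "1 \<le> c" "c \<le> n - 1" "c \<notin> set w"
    by (meson atLeastAtMost_iff subsetI)
  define split where "split M \<longleftrightarrow> M \<in> carrier_mat n n \<and>
    (\<forall>i<n. \<forall>j<n. (i < c) \<noteq> (j < c) \<longrightarrow> M $$ (i, j) = 0)" for M :: "real mat"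
  have mult: "split (M * N)" if "split M" "split N" for M N
  proof -
    have "(M * N) $$ (i, j) = 0" if ij: "i < n" "j < n" "(i < c) \<noteq> (j < c)" for i j
    proof -
      have "(M * N) $$ (i, j) = (\<Sum>k = 0..<n. M $$ (i, k) * N $$ (k, j))"
        using ij \<open>split M\<close> \<open>split N\<close> by (auto simp: split_def scalar_prod_def)
      also have "\<dots> = 0"
      proof (intro sum.neutral ballI)
        fix k assume "k \<in> {0..<n}"
        with ij \<open>split M\<close> \<open>split N\<close> show "M $$ (i, k) * N $$ (k, j) = 0"
          by (cases "(i < c) = (k < c)") (auto simp: split_def)
      qed
      finally show ?thesis .
    qed
    with that show ?thesis
      by (auto simp: split_def)
  qed
  have one: "split (1\<^sub>m n)"
    by (auto simp: split_def)
  have "split U"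
    using len letters c(3)
  proof (induction w as rule: list_induct2)
    case (Cons c' w a as)
    have "split (elem_factor n c' a)"
      using Cons.prems by (auto simp: split_def elem_factor_def mat_unit_def)
    with Cons mult show ?case by simp
  qed (simp add: one)
  then have "split (transpose_mat U)"
    by (auto simp: split_def)
  moreover have "split D"
    using D by (auto simp: split_def positive_diagonal_def diagonal_mat_def)
  ultimately have A: "split A"
    using \<open>split U\<close> by (intro mult)
  then have pow: "split (A ^\<^sub>m k)" for k
    by (induction k) (use one A carriers in \<open>auto intro: mult\<close>)
  from assms obtain k where "totally_positive (A ^\<^sub>m k)"
    by (auto simp: oscillatory_def)
  with pow[of k] have "0 < (A ^\<^sub>m k) $$ (0, c)"
    using c by (intro totally_positive_entry[of _ n]) (auto simp: split_def)
  moreover have "(A ^\<^sub>m k) $$ (0, c) = 0"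
    using pow[of k] c by (auto simp: split_def)
  ultimately show False by simp
qed

lemma bw_A: "bw A = longest_run w"
proof (rule bw_eq_longest_run[OF _ n letters])
  have Dp: "diagonal_mat D" "\<And>k. k < n \<Longrightarrow> 0 < D $$ (k, k)"
    using D by (auto simp: positive_diagonal_def)
  note entry = gram_entry[OF carriers(1,3) Dp(1)]
  note U = U_mat_entries[OF len letters pos]
  show "A \<in> carrier_mat n n"
    using carriers by (auto intro!: mult_carrier_mat)
  show "A $$ (i, j) = A $$ (j, i)" if "i < n" "j < n" for i j
    using that by (simp add: entry mult.commute mult.left_commute)
  show "\<exists>i' j'. i' \<le> i \<and> j \<le> j' \<and> subseq [Suc i'..<Suc j'] w"
    if ij: "i \<le> j" "j < n" "A $$ (i, j) \<noteq> 0" for i j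
  proof -
    \<comment> \<open>A nonzero summand \<open>k\<close> gives the run \<open>k + 1, ..., j\<close>
      with \<open>k \<le> i\<close>.\<close>
    from ij obtain k where "k < n" "U $$ (k, i) * D $$ (k, k) * U $$ (k, j) \<noteq> 0"
      using entry[of i j] by (auto elim: sum.not_neutral_contains_not_neutral)
    then have "k \<le> i" "subseq [Suc k..<Suc j] w"
      using U[of k i] U[of k j] ij by auto
    then show ?thesis by blast
  qed
  show "A $$ (i, j) \<noteq> 0" if ij: "i \<le> j" "j < n" "subseq [Suc i..<Suc j] w" for i j
  proof -
    \<comment> \<open>The summand \<open>k = i\<close> is bounded below: \<open>U $$ (i, i)\<close>
      belongs to the empty run and is positive.\<close>
    have "0 < U $$ (i, i) * D $$ (i, i) * U $$ (i, j)"
      using U_mat_pos_iff[OF len letters pos] Dp(2) ij by (intro mult_pos_pos) auto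
    also have "\<dots> \<le> (\<Sum>k<n. U $$ (k, i) * D $$ (k, k) * U $$ (k, j))"
      using U Dp(2) ij by (intro member_le_sum) (auto intro!: mult_nonneg_nonneg intro: less_imp_le)
    finally show ?thesis
      using entry[of i j] ij by simp
  qed
qed

lemma bw_B: "bw B = longest_run (rev w)"
proof (rule bw_eq_longest_run[OF _ n])
  \<comment> \<open>\<open>?W\<close> has positive parameters; \<open>V\<close> differs from it by
    checkerboard signs only.\<close>
  let ?W = "U_mat n (rev w) (rev as)"
  have Dp: "D' \<in> carrier_mat n n" "diagonal_mat D'" "\<And>k. k < n \<Longrightarrow> 0 < D' $$ (k, k)"
    using D by (auto simp: positive_diagonal_def diagonal_mat_def)
  have len': "length (rev w) = length (rev as)" and letters': "set (rev w) \<subseteq> {1..n - 1}"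
    and pos': "\<forall>a\<in>set (rev as). 0 < a"
    using len letters pos by auto
  note W = U_mat_entries[OF len' letters' pos']
  show "set (rev w) \<subseteq> {1..n - 1}"
    by (rule letters')
  have entry: "B $$ (i, j) = (-1) ^ (i + j) * (\<Sum>k<n. ?W $$ (i, k) * D' $$ (k, k) * ?W $$ (j, k))"
    if "i < n" "j < n" for i j
  proof -
    have "B = transpose_mat (transpose_mat V) * D' * transpose_mat V"
      by simp
    also have "\<dots> $$ (i, j) = (\<Sum>k<n. V $$ (i, k) * D' $$ (k, k) * V $$ (j, k))"
      using carriers(2) that by (subst gram_entry[of _ n]) (auto simp: Dp simp del: index_mat)
    also have "\<dots> = (\<Sum>k<n. (-1) ^ (i + j) * (?W $$ (i, k) * D' $$ (k, k) * ?W $$ (j, k)))"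
    proof (rule sum.cong)
      fix k assume "k \<in> {..<n}"
      then have "V $$ (i, k) = (-1) ^ (i + k) * ?W $$ (i, k)" "V $$ (j, k) = (-1) ^ (j + k) * ?W $$ (j, k)"
        using U_mat_uminus[OF len' letters'] that by auto
      \<comment> \<open>The dependence of the signs on \<open>k\<close> disappears, so all summands
        carry one common sign and cannot cancel.\<close>
      moreover have "(-1) ^ (i + k) * (-1) ^ (j + k) = ((-1) ^ (i + j) :: real)"
        by (simp add: power_add mult.commute mult.left_commute flip: power_mult_distrib)
      ultimately show "V $$ (i, k) * D' $$ (k, k) * V $$ (j, k) =
          (-1) ^ (i + j) * (?W $$ (i, k) * D' $$ (k, k) * ?W $$ (j, k))"
        by (simp add: mult_ac del: index_mat)
    qed simp
    finally show ?thesis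
      by (simp only: sum_distrib_left)
  qed
  show "B \<in> carrier_mat n n"
    using carriers by (auto intro!: mult_carrier_mat)
  show "B $$ (i, j) = B $$ (j, i)" if "i < n" "j < n" for i j
    using that by (simp add: entry mult.commute mult.left_commute add.commute del: index_mat)
  show "\<exists>i' j'. i' \<le> i \<and> j \<le> j' \<and> subseq [Suc i'..<Suc j'] (rev w)"
    if ij: "i \<le> j" "j < n" "B $$ (i, j) \<noteq> 0" for i j
  proof -
    from ij obtain k where "k < n" "?W $$ (i, k) * D' $$ (k, k) * ?W $$ (j, k) \<noteq> 0"
      using entry[of i j] by (auto elim: sum.not_neutral_contains_not_neutral simp del: index_mat)
    then have "j \<le> k" "subseq [Suc i..<Suc k] (rev w)"
      using W[of i k] W[of j k] ij by auto
    then show ?thesis by blast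
  qed
  show "B $$ (i, j) \<noteq> 0" if ij: "i \<le> j" "j < n" "subseq [Suc i..<Suc j] (rev w)" for i j
  proof -
    \<comment> \<open>Since \<open>B\<close> has the factors in the opposite order, the diagonal
      entry is now supplied by \<open>k = j\<close>.\<close>
    have "0 < ?W $$ (i, j) * D' $$ (j, j) * ?W $$ (j, j)"
      using U_mat_pos_iff[OF len' letters' pos'] Dp(3) ij by (intro mult_pos_pos) (auto simp del: index_mat)
    also have "\<dots> \<le> (\<Sum>k<n. ?W $$ (i, k) * D' $$ (k, k) * ?W $$ (j, k))"
      using W Dp(3) ij
      by (intro member_le_sum[of j]) (auto intro!: mult_nonneg_nonneg intro: less_imp_le simp del: index_mat)
    finally show ?thesis
      using entry[of i j] ij by simp
  qed
qed

lemma A_mult_B: "A * B = 1\<^sub>m n"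
proof -
  have UV: "U * V = 1\<^sub>m n"
    using len letters by (rule U_mat_inverse)
  then have "V * U = 1\<^sub>m n"
    by (rule mat_mult_left_right_inverse[OF carriers(1,2)])
  then have tr: "transpose_mat U * transpose_mat V = 1\<^sub>m n"
    using transpose_mult[OF carriers(2,1)] by simp
  have DD: "D * D' = 1\<^sub>m n"
  proof (rule eq_matI)
    fix i j assume "i < dim_row (1\<^sub>m n :: real mat)" "j < dim_col (1\<^sub>m n :: real mat)"
    then have ij: "i < n" "j < n" by auto
    have "(D * D') $$ (i, j) = D $$ (i, j) * D' $$ (j, j)"
      using ij carriers by (intro mult_diagonal_entry[of _ n]) (auto simp: diagonal_mat_def)
    with ij D show "(D * D') $$ (i, j) = 1\<^sub>m n $$ (i, j)"
      by (auto simp: positive_diagonal_def diagonal_mat_def)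
  qed (use carriers in auto)
  have "A * B = transpose_mat U * (D * ((U * V) * (D' * transpose_mat V)))"
    using carriers by (simp add: assoc_mult_mat[of _ n n _ n _ n] mult_carrier_mat[of _ n n _ n])
  also have "\<dots> = transpose_mat U * ((D * D') * transpose_mat V)"
    using carriers UV by (simp add: assoc_mult_mat[of _ n n _ n _ n] mult_carrier_mat[of _ n n _ n])
  also have "\<dots> = 1\<^sub>m n"
    using carriers by (simp add: DD tr)
  finally show ?thesis .
qed

text \<open>Every inverse of \<open>A\<close> equals \<open>B\<close>, so the existential reduces to
  \<open>bw B\<close>. What remains is a condition on the word alone.\<close>

lemma oscillatory_with_bandwidths_iff:
  "oscillatory_with_bandwidths n p q A \<longleftrightarrow>
     set w = {1..n - 1} \<and> longest_run w = p \<and> longest_run (rev w) = q"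
proof -
  have carr: "A \<in> carrier_mat n n" "B \<in> carrier_mat n n"
    using carriers by (auto intro!: mult_carrier_mat)
  have BA: "B * A = 1\<^sub>m n"
    using carr A_mult_B by (rule mat_mult_left_right_inverse)
  have unique: "B' = B" if B': "B' \<in> carrier_mat n n" "inverts_mat B' A" for B'
  proof -
    have "B' * A = 1\<^sub>m n"
      using B' by (simp add: inverts_mat_def)
    then have "B' * A * B = B"
      by (simp only: left_mult_one_mat[OF carr(2)])
    then show ?thesis
      using B' carr A_mult_B by (simp add: assoc_mult_mat[of _ n n A n _ n])
  qed
  have inv: "inverts_mat A B" "inverts_mat B A"
    using carr A_mult_B BA by (auto simp: inverts_mat_def)
  have ex: "(\<exists>B' \<in> carrier_mat n n. inverts_mat A B' \<and> inverts_mat B' A \<and> bw B' = q) \<longleftrightarrow>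
      longest_run (rev w) = q"
  proof
    assume "\<exists>B' \<in> carrier_mat n n. inverts_mat A B' \<and> inverts_mat B' A \<and> bw B' = q"
    then obtain B' where "B' \<in> carrier_mat n n" "inverts_mat B' A" "bw B' = q" by blast
    with unique[of B'] bw_B show "longest_run (rev w) = q" by simp
  next
    assume "longest_run (rev w) = q"
    then show "\<exists>B' \<in> carrier_mat n n. inverts_mat A B' \<and> inverts_mat B' A \<and> bw B' = q"
      using carr(2) inv bw_B by (intro bexI[of _ B] conjI) (simp_all only:)
  qed
  have osc: "oscillatory A \<longleftrightarrow> set w = {1..n - 1}"
    using oscillatory_if_all_letters all_letters_if_oscillatory letters by blast
  show ?thesis
    by (simp only: oscillatory_with_bandwidths_def ex osc bw_A carr(1) simp_thms)
qed

end

section \<open>The minimal length\<close>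

theorem corollary4p2:
  fixes n p q :: nat
  assumes "n \<ge> 2"
    and "(p, q) \<in> admissible_pairs n"
  shows "max (n - 1) (p + q - 1) \<in> factorization_lengths n p q \<and>
         (\<forall>L \<in> factorization_lengths n p q. max (n - 1) (p + q - 1) \<le> L)"
proof (intro conjI ballI)
  have "\<exists>w. length w = max (n - 1) (p + q - 1) \<and> set w = {1..n - 1} \<and>
      longest_run w = p \<and> longest_run (rev w) = q"
  \<comment> \<open>The cases decide which term of the maximum is larger. Pairs containing 1 satisfy
    \<open>p + q = n\<close> and fall under the first.\<close>
  proof (cases "p + q \<le> n")
    case True
    then have "max (n - 1) (p + q - 1) = n - 1" by simp
    with word_exists_short[of p q n] assms True show ?thesis
      by (auto simp: admissible_pairs_def)
  next
    case False
    then have "max (n - 1) (p + q - 1) = p + q - 1" by simp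
    with word_exists_long[of p n q] assms False show ?thesis
      by (auto simp: admissible_pairs_def)
  qed
  then obtain w where w: "length w = max (n - 1) (p + q - 1)" "set w = {1..n - 1}"
    "longest_run w = p" "longest_run (rev w) = q" by blast
  \<comment> \<open>The bandwidths and oscillation depend on \<open>w\<close> only, so all
    parameters and the diagonal entries may be 1.\<close>
  let ?as = "replicate (length w) (1 :: real)"
  have D: "positive_diagonal n (1\<^sub>m n)"
    by (auto simp: positive_diagonal_def diagonal_mat_def)
  then interpret symmetric_factorization n w ?as "1\<^sub>m n"
    using w assms(1) by unfold_locales auto
  have "oscillatory_with_bandwidths n p q (transpose_mat (U_mat n w ?as) * 1\<^sub>m n * U_mat n w ?as)"
    using w(2-4) by (simp only: oscillatory_with_bandwidths_iff)
  with D w(1,2) show "max (n - 1) (p + q - 1) \<in> factorization_lengths n p q"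
    unfolding factorization_lengths_def
    by (intro CollectI exI[of _ w] exI[of _ ?as] exI[of _ "1\<^sub>m n"]) simp
next
  fix L assume "L \<in> factorization_lengths n p q"
  then obtain w as D where L: "L = length w" and w: "set w \<subseteq> {1..n - 1}" "length as = length w"
    "\<forall>a\<in>set as. 0 < a" "positive_diagonal n D"
    "oscillatory_with_bandwidths n p q (transpose_mat (U_mat n w as) * D * U_mat n w as)"
    unfolding factorization_lengths_def by blast
  interpret symmetric_factorization n w as D
    using assms(1) w by unfold_locales auto
  have runs: "set w = {1..n - 1}" "longest_run w = p" "longest_run (rev w) = q"
    using w(5) by (simp_all add: oscillatory_with_bandwidths_iff)
  have "n - 1 \<le> length w"
    using card_length[of w] runs(1) by simp
  then show "max (n - 1) (p + q - 1) \<le> L"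
    using longest_run_add_rev[of w] runs L by simp
qed

end
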